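(* Consider normal incidence, $k_x=0$. Suppose that a Siegert state $E_n$ exists at the pole $\zeta_n=k_n^2-i\Gamma_n$ of the generalized resolvent $\zeta\mapsto[1-\widehat{\mathrm H}(\zeta)]^{-1}$, with $k_n>0$ and $\Gamma_n>0$ (i.e. the Siegert state is not a bound state in the radiation continuum). Then this state, when excited by an incident wave packet, decays with time by emitting a monochromatic radiation at the wavenumber $\widetilde k_n$ and with the life time $\tau_n$, where $$\widetilde k_n=\sqrt{\frac{k_n^2+\sqrt{k_n^4+\Gamma_n^2}}{2}}\ \xrightarrow[\Gamma_n\ll1]{}\ k_n,\qquad \tau_n=\frac{2\widetilde k_n}{c\,\Gamma_n}\ \xrightarrow[\Gamma_n\ll1]{}\ \frac{2k_n}{c\,\Gamma_n}.$$
   Context: The square root is $\sqrt w=e^{\frac12\log w}$ with $\log w=\ln|w|+i\arg w$, $-\frac{\pi}{2}<\arg w<\frac{3\pi}{2}$. The dielectric function $\varepsilon:\mathbb{R}^2\to[1,\infty)$ is a bounded function of $(x,z)$, $1$-periodic in $x$, with $\varepsilon-1$ supported, within the strip $[0,1]\times\mathbb{R}$, in a rectangle $D=[0,1]\times[z_-,z_+]$. The electric field $E(\mathbf r,t)$ satisfies $\frac{\varepsilon}{c^2}\partial_t^2E=\Delta E$, where $\Delta=\partial_x^2+\partial_z^2$ and $c$ is the speed of light in vacuum. For $\zeta$ in the plane $\mathbb{C}$ cut along the half-lines $\{(2\pi m)^2-is:s\ge0\}$, $m\in\mathbb{Z}$, $\widehat{\mathrm H}(\zeta)$ is the Hilbert–Schmidt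 operator on $L^2(D)$ with kernel $(\varepsilon(\mathbf r_0)-1)H(\zeta;\mathbf r-\mathbf r_0)$, where $H(\zeta;x,z)=\frac{i\zeta}{2}\sum_{m\in\mathbb{Z}}\frac{e^{i(2\pi mx+|z|\sqrt{\zeta-(2\pi m)^2})}}{\sqrt{\zeta-(2\pi m)^2}}$. The function $[1-\widehat{\mathrm H}(\zeta)]^{-1}$ is meromorphic in the cut plane; its poles are assumed simple with rank-one residues. A Siegert state at a pole $\zeta_n$ is a nonzero solution $E_n\in L^2(D)$ of $\widehat{\mathrm H}(\zeta_n)[E_n]=E_n$. For wavenumber $k$ and wave vector $\mathbf k=(0,\pm k)$, the stationary amplitude $E_\omega=[1-\widehat{\mathrm H}(k^2)]^{-1}[e^{i\mathbf k\cdot\mathbf r}]$ is meromorphic in $k^2$ and contains the resonant term $\frac{a_n}{k^2-k_n^2+i\Gamma_n}E_n$, $a_n\in\mathbb{C}$. An incident wave packet $\int_0^\infty A(k)\cos(\mathbf k\cdot\mathbf r-ckt)\,dk$, with wavenumber distribution $A(k)$, generates the field $\mathrm{Re}\int_0^\infty A(k)E_\omega(\mathbf r)e^{-ickt}\,dk$, in which the Siegert state $E_n$ appears with the time-dependent amplitude $\Omega_n(t)=a_n\int_0^\infty\frac{A(k)}{k^2-k_n^2+i\Gamma_n}e^{-ickt}\,dk$. The decay statement refers to the contribution of the pole at $k=\sqrt{\zeta_n}$ to $\Omega_n(t)$: it is proportional to $A(\sqrt{\zeta_n})\,e^{-ict\sqrt{\zeta_n}}$, and $\sqrt{\zeta_n}=\widetilde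 k_n-\frac{i}{c\tau_n}$, so it varies in time as $e^{-ic\widetilde k_nt}e^{-t/\tau_n}$. *)

theory Defs
  imports "HOL-Complex_Analysis.Complex_Analysis" "HOL-Library.Landau_Symbols"
begin

section \<open>The branch of the square root\<close>

text \<open>
  The argument takes values in the open interval from \<open>-pi/2\<close> to \<open>3*pi/2\<close> off the cut along the
  negative imaginary half-line (see the two lemmas below). On the cut itself, the origin
  included, the values are junk; they are never used for arguments taken from the cut plane.
\<close>

definition arg_cut :: "complex \<Rightarrow> real" where
  "arg_cut w = Arg (- \<i> * w) + pi / 2"

definition log_cut :: "complex \<Rightarrow> complex" where
  "log_cut w = of_real (ln (norm w)) + \<i> * of_real (arg_cut w)"

definition sqrt_cut :: "complex \<Rightarrow> complex" where
  "sqrt_cut w = exp (log_cut w / 2)"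

lemma arg_cut_bounds:
  assumes "\<not> (Re w = 0 \<and> Im w \<le> 0)"
  shows "- pi / 2 < arg_cut w" "arg_cut w < 3 * pi / 2"
proof -
  have "Arg (- \<i> * w) \<noteq> pi"
    using assms by (auto simp: Arg_eq_pi)
  then show "- pi / 2 < arg_cut w" "arg_cut w < 3 * pi / 2"
    using mpi_less_Arg[of "- \<i> * w"] Arg_le_pi[of "- \<i> * w"]
    by (auto simp: arg_cut_def)
qed

lemma cis_arg_cut: "of_real (norm w) * cis (arg_cut w) = w"
proof -
  have "of_real (norm w) * cis (Arg (- \<i> * w)) = - \<i> * w"
    using rcis_cmod_Arg[of "- \<i> * w"] by (simp add: rcis_def norm_mult)
  then have "of_real (norm w) * (cis (Arg (- \<i> * w)) * \<i>) = - \<i> * w * \<i>"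
    by (metis mult.assoc)
  also have "\<dots> = w"
    by (simp add: complex_eq_iff)
  finally show ?thesis
    by (simp add: arg_cut_def flip: cis_mult)
qed

definition cut_plane :: "complex set" where
  "cut_plane = - {Complex ((2 * pi * real_of_int m)\<^sup>2) (- s) | m s. s \<ge> 0}"


section \<open>The dielectric structure\<close>

definition cell :: "real \<Rightarrow> real \<Rightarrow> (real \<times> real) set" where
  "cell zm zp = {0..1} \<times> {zm..zp}"

definition dielectric :: "real \<Rightarrow> real \<Rightarrow> (real \<times> real \<Rightarrow> real) \<Rightarrow> bool" where
  "dielectric zm zp \<epsilon> \<longleftrightarrow>
     \<epsilon> \<in> borel_measurable lebesgue \<and>
     bounded (range \<epsilon>) \<and>
     (\<forall>r. 1 \<le> \<epsilon> r) \<and>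
     (\<forall>x z. \<epsilon> (x + 1, z) = \<epsilon> (x, z)) \<and>
     (\<forall>x z. x \<in> {0..1} \<longrightarrow> z \<notin> {zm..zp} \<longrightarrow> \<epsilon> (x, z) = 1)"


section \<open>Square-integrable functions and bounded operators\<close>

text \<open>
  Elements of \<open>L\<^sup>2(D)\<close> are represented by functions on the plane, restricted to \<open>D\<close> and
  identified when they agree almost everywhere on \<open>D\<close>.
\<close>

type_synonym field = "real \<times> real \<Rightarrow> complex"

definition L2 :: "(real \<times> real) set \<Rightarrow> field set" where
  "L2 D = {f. f \<in> borel_measurable (lebesgue_on D) \<and>
              integrable (lebesgue_on D) (\<lambda>r. (norm (f r))\<^sup>2)}"

definition L2_norm :: "(real \<times> real) set \<Rightarrow> field \<Rightarrow> real" where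
  "L2_norm D f = sqrt (LINT r|lebesgue_on D. (norm (f r))\<^sup>2)"

definition L2_eq :: "(real \<times> real) set \<Rightarrow> field \<Rightarrow> field \<Rightarrow> bool" where
  "L2_eq D f g \<longleftrightarrow> (AE r in lebesgue_on D. f r = g r)"

definition L2_operator :: "(real \<times> real) set \<Rightarrow> (field \<Rightarrow> field) \<Rightarrow> bool" where
  "L2_operator D T \<longleftrightarrow>
     (\<forall>f\<in>L2 D. T f \<in> L2 D) \<and>
     (\<forall>f\<in>L2 D. \<forall>g\<in>L2 D. L2_eq D f g \<longrightarrow> L2_eq D (T f) (T g)) \<and>
     (\<forall>f\<in>L2 D. \<forall>g\<in>L2 D. \<forall>u v. L2_eq D (T (\<lambda>r. u * f r + v * g r)) (\<lambda>r. u * T f r + v * T g r)) \<and>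
     (\<exists>K. \<forall>f\<in>L2 D. L2_norm D (T f) \<le> K * L2_norm D f)"

definition L2_holomorphic_on :: "(real \<times> real) set \<Rightarrow> (complex \<Rightarrow> field) \<Rightarrow> complex set \<Rightarrow> bool" where
  "L2_holomorphic_on D F U \<longleftrightarrow>
     (\<forall>\<zeta>\<in>U. F \<zeta> \<in> L2 D) \<and>
     (\<forall>\<zeta>\<in>U. \<exists>F'\<in>L2 D. \<forall>e>0. \<exists>d>0. \<forall>w\<in>U. norm (w - \<zeta>) < d \<longrightarrow>
        L2_norm D (\<lambda>r. F w r - F \<zeta> r - (w - \<zeta>) * F' r) \<le> e * norm (w - \<zeta>))"

text \<open>Holomorphy of operator-valued functions, with respect to the operator norm.\<close>

definition operator_holomorphic_on ::
    "(real \<times> real) set \<Rightarrow> (complex \<Rightarrow> field \<Rightarrow> field) \<Rightarrow> complex set \<Rightarrow> bool" where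
  "operator_holomorphic_on D T U \<longleftrightarrow>
     (\<forall>\<zeta>\<in>U. L2_operator D (T \<zeta>)) \<and>
     (\<forall>\<zeta>\<in>U. \<exists>T'. L2_operator D T' \<and> (\<forall>e>0. \<exists>d>0. \<forall>w\<in>U. norm (w - \<zeta>) < d \<longrightarrow>
        (\<forall>f\<in>L2 D. L2_norm D (\<lambda>r. T w f r - T \<zeta> f r - (w - \<zeta>) * T' f r)
                    \<le> e * norm (w - \<zeta>) * L2_norm D f)))"

definition rank_one :: "(real \<times> real) set \<Rightarrow> (field \<Rightarrow> field) \<Rightarrow> bool" where
  "rank_one D P \<longleftrightarrow> L2_operator D P \<and>
     (\<exists>u\<in>L2 D. \<exists>l. \<not> L2_eq D u (\<lambda>r. 0) \<and> (\<exists>f\<in>L2 D. l f \<noteq> 0) \<and>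
        (\<forall>f\<in>L2 D. L2_eq D (P f) (\<lambda>r. l f * u r)))"


section \<open>The operator and its generalized resolvent\<close>

text \<open>
  The series converges absolutely when \<open>z \<noteq> 0\<close>. At \<open>z = 0\<close> it does not; this only concerns a
  null set in the integral operator below.
\<close>

definition H_kernel :: "complex \<Rightarrow> field" where
  "H_kernel \<zeta> = (\<lambda>(x, z). \<i> * \<zeta> / 2 *
     (\<Sum>\<^sub>\<infinity>m\<in>(UNIV :: int set).
        (let q = sqrt_cut (\<zeta> - of_real ((2 * pi * real_of_int m)\<^sup>2))
         in exp (\<i> * (of_real (2 * pi * real_of_int m * x) + of_real \<bar>z\<bar> * q)) / q)))"

definition H_op ::
    "(real \<times> real) set \<Rightarrow> (real \<times> real \<Rightarrow> real) \<Rightarrow> complex \<Rightarrow> field \<Rightarrow> field" where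
  "H_op D \<epsilon> \<zeta> f = (\<lambda>r. LINT r0|lebesgue_on D. of_real (\<epsilon> r0 - 1) * H_kernel \<zeta> (r - r0) * f r0)"

definition inverse_at ::
    "(real \<times> real) set \<Rightarrow> (real \<times> real \<Rightarrow> real) \<Rightarrow> complex \<Rightarrow> (field \<Rightarrow> field) \<Rightarrow> bool" where
  "inverse_at D \<epsilon> \<zeta> T \<longleftrightarrow> L2_operator D T \<and>
     (\<forall>f\<in>L2 D. L2_eq D (\<lambda>r. T f r - H_op D \<epsilon> \<zeta> (T f) r) f \<and>
                L2_eq D (T (\<lambda>r. f r - H_op D \<epsilon> \<zeta> f r)) f)"

definition invertible_at ::
    "(real \<times> real) set \<Rightarrow> (real \<times> real \<Rightarrow> real) \<Rightarrow> complex \<Rightarrow> bool" where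
  "invertible_at D \<epsilon> \<zeta> \<longleftrightarrow> (\<exists>T. inverse_at D \<epsilon> \<zeta> T)"

text \<open>The inverse is unique up to equality almost everywhere.\<close>

definition resolvent ::
    "(real \<times> real) set \<Rightarrow> (real \<times> real \<Rightarrow> real) \<Rightarrow> complex \<Rightarrow> field \<Rightarrow> field" where
  "resolvent D \<epsilon> \<zeta> = (SOME T. inverse_at D \<epsilon> \<zeta> T)"

text \<open>
  Laurent expansion with finite principal part \<open>P 1, \<dots>, P N\<close> in a punctured disc about \<open>\<zeta>0\<close>;
  \<open>P 1\<close> is the residue.
\<close>

definition resolvent_expansion ::
    "(real \<times> real) set \<Rightarrow> (real \<times> real \<Rightarrow> real) \<Rightarrow> complex \<Rightarrow> nat \<Rightarrow>
       (nat \<Rightarrow> field \<Rightarrow> field) \<Rightarrow> bool" where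
  "resolvent_expansion D \<epsilon> \<zeta>0 N P \<longleftrightarrow>
     (\<forall>j\<in>{1..N}. L2_operator D (P j)) \<and>
     (\<exists>\<rho>>0. \<exists>B. operator_holomorphic_on D B (ball \<zeta>0 \<rho>) \<and>
        (\<forall>\<zeta>\<in>ball \<zeta>0 \<rho> - {\<zeta>0}. invertible_at D \<epsilon> \<zeta> \<and>
           (\<forall>f\<in>L2 D. L2_eq D (resolvent D \<epsilon> \<zeta> f)
              (\<lambda>r. (\<Sum>j=1..N. P j f r / (\<zeta> - \<zeta>0) ^ j) + B \<zeta> f r))))"

definition resolvent_meromorphic ::
    "(real \<times> real) set \<Rightarrow> (real \<times> real \<Rightarrow> real) \<Rightarrow> bool" where
  "resolvent_meromorphic D \<epsilon> \<longleftrightarrow>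
     (\<forall>\<zeta>0\<in>cut_plane. \<exists>N P. resolvent_expansion D \<epsilon> \<zeta>0 N P)"

definition resolvent_pole ::
    "(real \<times> real) set \<Rightarrow> (real \<times> real \<Rightarrow> real) \<Rightarrow> complex \<Rightarrow> nat \<Rightarrow>
       (nat \<Rightarrow> field \<Rightarrow> field) \<Rightarrow> bool" where
  "resolvent_pole D \<epsilon> \<zeta>0 N P \<longleftrightarrow> \<zeta>0 \<in> cut_plane \<and> N \<ge> 1 \<and>
     resolvent_expansion D \<epsilon> \<zeta>0 N P \<and> (\<exists>f\<in>L2 D. \<not> L2_eq D (P N f) (\<lambda>r. 0))"

definition siegert_state ::
    "(real \<times> real) set \<Rightarrow> (real \<times> real \<Rightarrow> real) \<Rightarrow> complex \<Rightarrow> field \<Rightarrow> bool" where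
  "siegert_state D \<epsilon> \<zeta> E \<longleftrightarrow> E \<in> L2 D \<and> \<not> L2_eq D E (\<lambda>r. 0) \<and> L2_eq D (H_op D \<epsilon> \<zeta> E) E"


section \<open>Scattering at normal incidence\<close>

text \<open>
  The wave vector is \<open>(0, \<sigma> * k)\<close> with \<open>\<sigma> = 1\<close> or \<open>\<sigma> = -1\<close>. As functions of \<open>\<zeta> = k\<^sup>2\<close> the incident
  wave and the stationary amplitude are continued off the positive half-line by \<open>k = sqrt_cut \<zeta>\<close>.
\<close>

definition incident_wave :: "real \<Rightarrow> complex \<Rightarrow> field" where
  "incident_wave \<sigma> \<zeta> = (\<lambda>(x, z). exp (\<i> * of_real \<sigma> * sqrt_cut \<zeta> * of_real z))"

definition stationary_amplitude ::
    "(real \<times> real) set \<Rightarrow> (real \<times> real \<Rightarrow> real) \<Rightarrow> real \<Rightarrow> complex \<Rightarrow> field" where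
  "stationary_amplitude D \<epsilon> \<sigma> \<zeta> = resolvent D \<epsilon> \<zeta> (incident_wave \<sigma> \<zeta>)"

text \<open>
  The stationary amplitude contains the resonant term \<open>a / (\<zeta> - \<zeta>n) * E\<close>: what remains after
  subtracting it is holomorphic near \<open>\<zeta>n\<close>.
\<close>

definition resonant_coefficient ::
    "(real \<times> real) set \<Rightarrow> (real \<times> real \<Rightarrow> real) \<Rightarrow> real \<Rightarrow> complex \<Rightarrow> field \<Rightarrow> complex \<Rightarrow> bool" where
  "resonant_coefficient D \<epsilon> \<sigma> \<zeta>n E a \<longleftrightarrow>
     (\<exists>\<rho>>0. \<exists>F. L2_holomorphic_on D F (ball \<zeta>n \<rho>) \<and>
        (\<forall>\<zeta>\<in>ball \<zeta>n \<rho> - {\<zeta>n}.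
           L2_eq D (stationary_amplitude D \<epsilon> \<sigma> \<zeta>) (\<lambda>r. a / (\<zeta> - \<zeta>n) * E r + F \<zeta> r)))"

text \<open>
  Field generated by the wave packet; \<open>Estat k\<close> is a representative of the stationary amplitude
  at wavenumber \<open>k\<close>.
\<close>

definition excited_field ::
    "real \<Rightarrow> (complex \<Rightarrow> complex) \<Rightarrow> (real \<Rightarrow> field) \<Rightarrow> real \<times> real \<Rightarrow> real \<Rightarrow> real" where
  "excited_field c A Estat r t =
     Re (LINT k:{0<..}|lborel. A (of_real k) * Estat k r * exp (- \<i> * of_real (c * k * t)))"

text \<open>
  Integrand of the time-dependent amplitude, with \<open>A\<close> the analytic continuation of the
  wavenumber distribution.
\<close>

definition amplitude_integrand ::
    "real \<Rightarrow> (complex \<Rightarrow> complex) \<Rightarrow> complex \<Rightarrow> complex \<Rightarrow> real \<Rightarrow> complex \<Rightarrow> complex" where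
  "amplitude_integrand c A \<zeta>n a t k = a * (A k / (k\<^sup>2 - \<zeta>n) * exp (- \<i> * of_real c * k * of_real t))"

definition siegert_amplitude ::
    "real \<Rightarrow> (complex \<Rightarrow> complex) \<Rightarrow> complex \<Rightarrow> complex \<Rightarrow> real \<Rightarrow> complex" where
  "siegert_amplitude c A \<zeta>n a t =
     (LINT k:{0<..}|lborel. amplitude_integrand c A \<zeta>n a t (of_real k))"

text \<open>
  The minus sign accounts for the orientation: the contour is pushed from the positive half-line
  down across the pole, which is thereby encircled clockwise.
\<close>

definition pole_contribution ::
    "real \<Rightarrow> (complex \<Rightarrow> complex) \<Rightarrow> complex \<Rightarrow> complex \<Rightarrow> real \<Rightarrow> complex" where
  "pole_contribution c A \<zeta>n a t =
     - (2 * of_real pi * \<i>) * residue (amplitude_integrand c A \<zeta>n a t) (sqrt_cut \<zeta>n)"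

definition k_tilde :: "real \<Rightarrow> real \<Rightarrow> real" where
  "k_tilde kn \<Gamma> = sqrt ((kn\<^sup>2 + sqrt (kn ^ 4 + \<Gamma>\<^sup>2)) / 2)"

definition life_time :: "real \<Rightarrow> real \<Rightarrow> real \<Rightarrow> real" where
  "life_time c kn \<Gamma> = 2 * k_tilde kn \<Gamma> / (c * \<Gamma>)"

end

(* In the half-plane Re k > 0 the only zero of k^2 - \<zeta>n is the branch value s of the square root,
   which lies strictly below the real axis. Hence the integrand of the amplitude is holomorphic on S
   except for a simple pole at s, and pushing the contour across s picks up -2*pi*\<i> times the residue
   there, whose time dependence is the factor exp (-\<i>*c*t*s); Re s and Im s follow from s^2 = \<zeta>n. *)
theory Submission
  imports Defs
begin

section \<open>The square root of the pole, in closed form\<close>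

lemma sqrt_cut_squared:
  assumes "w \<noteq> 0"
  shows "(sqrt_cut w)\<^sup>2 = w"
proof -
  have "(sqrt_cut w)\<^sup>2 = exp (log_cut w)"
    by (simp add: sqrt_cut_def flip: exp_double)
  \<comment> \<open>\<open>w \<noteq> 0\<close> turns \<open>exp (ln (norm w))\<close> into
    \<open>norm w\<close>. At 0 the claim fails, as \<open>sqrt_cut\<close> is an exponential and
    never vanishes.\<close>
  also have "\<dots> = of_real (norm w) * cis (arg_cut w)"
    using assms by (simp add: log_cut_def exp_add exp_of_real cis_conv_exp)
  finally show ?thesis
    by (simp add: cis_arg_cut)
qed

text \<open>The factor \<open>- \<i>\<close> rotates the right half-plane into the lower one, so
  \<open>arg_cut w\<close> stays between \<open>- pi / 2\<close> and \<open>pi / 2\<close>, and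
  halving it keeps the cosine positive.\<close>

lemma Re_sqrt_cut_pos:
  assumes "Re w > 0"
  shows "Re (sqrt_cut w) > 0"
proof -
  have "Arg (- \<i> * w) < 0"
    using assms by (simp add: Arg_neg_iff)
  then have "- pi / 2 < arg_cut w / 2" "arg_cut w / 2 < pi / 2"
    using mpi_less_Arg[of "- \<i> * w"] by (auto simp: arg_cut_def)
  then have "cos (arg_cut w / 2) > 0"
    by (intro cos_gt_zero_pi) auto
  then show ?thesis
    by (simp add: sqrt_cut_def log_cut_def Re_exp)
qed

lemma k_tilde_pos:
  assumes "\<Gamma> > 0"
  shows "k_tilde kn \<Gamma> > 0"
proof -
  have "sqrt (kn ^ 4 + \<Gamma>\<^sup>2) > 0"
    using assms by (simp add: add_nonneg_pos)
  then show ?thesis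
    by (simp add: k_tilde_def add_nonneg_pos)
qed

text \<open>For the root x + iy, comparing real parts, imaginary parts and moduli in its square
  gives the difference and the sum of the squares of x and y, hence x up to sign. Positivity of x
  selects the branch, and the imaginary part then yields y.\<close>

lemma sqrt_cut_resonance:
  assumes "kn > 0" "\<Gamma> > 0"
  shows "sqrt_cut (of_real (kn\<^sup>2) - \<i> * of_real \<Gamma>) =
           Complex (k_tilde kn \<Gamma>) (- \<Gamma> / (2 * k_tilde kn \<Gamma>))"
proof -
  define w where "w = complex_of_real (kn\<^sup>2) - \<i> * of_real \<Gamma>"
  define x y where "x = Re (sqrt_cut w)" and "y = Im (sqrt_cut w)"
  have Rew: "Re w = kn\<^sup>2" "Im w = - \<Gamma>"
    by (simp_all add: w_def flip: of_real_power)
  then have "w \<noteq> 0" and x: "x > 0"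
    using assms Re_sqrt_cut_pos[of w] by (auto simp: x_def)
  then have sq: "(sqrt_cut w)\<^sup>2 = w"
    by (simp add: sqrt_cut_squared)
  have re: "x\<^sup>2 - y\<^sup>2 = kn\<^sup>2" and im: "2 * x * y = - \<Gamma>"
    using arg_cong[OF sq, of Re] arg_cong[OF sq, of Im]
    by (simp_all add: Rew x_def y_def Re_power2 Im_power2)
  have "(x\<^sup>2 + y\<^sup>2)\<^sup>2 = (x\<^sup>2 - y\<^sup>2)\<^sup>2 + (2 * x * y)\<^sup>2"
    by algebra
  also have "\<dots> = kn ^ 4 + \<Gamma>\<^sup>2"
    by (simp add: re im)
  finally have "sqrt (kn ^ 4 + \<Gamma>\<^sup>2) = x\<^sup>2 + y\<^sup>2"
    by (intro real_sqrt_unique) auto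
  with re have "(kn\<^sup>2 + sqrt (kn ^ 4 + \<Gamma>\<^sup>2)) / 2 = x\<^sup>2"
    by simp
  with x have "k_tilde kn \<Gamma> = x"
    by (simp add: k_tilde_def)
  moreover have "y = - \<Gamma> / (2 * x)"
    using im x by (simp add: field_simps)
  ultimately show ?thesis
    unfolding w_def[symmetric] by (simp add: complex_eq_iff x_def y_def)
qed

section \<open>Asymptotics for narrow resonances\<close>

lemma k_tilde_narrow_resonance:
  assumes "kn > 0"
  shows "(k_tilde kn \<longlongrightarrow> kn) (at_right 0)"
proof -
  have "((\<lambda>G. sqrt ((kn\<^sup>2 + sqrt (kn ^ 4 + G\<^sup>2)) / 2)) \<longlongrightarrow> sqrt ((kn\<^sup>2 + sqrt (kn ^ 4 + 0\<^sup>2)) / 2))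
          (at_right 0)"
    by (intro tendsto_intros) auto
  moreover have "sqrt (kn ^ 4) = kn\<^sup>2"
    by (intro real_sqrt_unique) auto
  ultimately show ?thesis
    using assms by (simp add: k_tilde_def[abs_def])
qed

lemma life_time_narrow_resonance:
  assumes "c > 0" "kn > 0"
  shows "life_time c kn \<sim>[at_right 0] (\<lambda>G. 2 * kn / (c * G))"
proof -
  have "k_tilde kn \<sim>[at_right 0] (\<lambda>_. kn)"
    using k_tilde_narrow_resonance[OF assms(2)] assms by (simp add: tendsto_imp_asymp_equiv_const)
  then show ?thesis
    unfolding life_time_def[abs_def] by (intro asymp_equiv_intros)
qed

text \<open>Asymptotic equivalence alone does not give this, since both terms diverge as G tends to
  0. What makes the difference vanish is that \<open>k_tilde kn G - kn\<close> is of second order in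
  G.\<close>

lemma life_time_narrow_resonance_diff:
  assumes c: "c > 0" and kn: "kn > 0"
  shows "((\<lambda>G. life_time c kn G - 2 * kn / (c * G)) \<longlongrightarrow> 0) (at_right 0)"
proof -
  define R where "R = (\<lambda>G. sqrt (kn ^ 4 + G\<^sup>2))"
  have R: "R G \<ge> 0" for G
    by (simp add: R_def)
  have pos: "c * (R G + kn\<^sup>2) * (k_tilde kn G + kn) > 0" for G
    using c kn R[of G] by (intro mult_pos_pos add_nonneg_pos) (auto simp: k_tilde_def)
  \<comment> \<open>rationalising the difference of square roots twice gains a factor \<open>G\<^sup>2\<close>\<close>
  have eq: "life_time c kn G - 2 * kn / (c * G) = G / (c * (R G + kn\<^sup>2) * (k_tilde kn G + kn))"
    if "G > 0" for G
  proof -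
    have "(k_tilde kn G)\<^sup>2 = (kn\<^sup>2 + R G) / 2"
      using R[of G] by (simp add: k_tilde_def R_def)
    moreover have "(R G)\<^sup>2 = kn ^ 4 + G\<^sup>2"
      by (simp add: R_def)
    ultimately have "2 * (k_tilde kn G - kn) * ((R G + kn\<^sup>2) * (k_tilde kn G + kn)) = G\<^sup>2"
      by algebra
    then have "(2 * k_tilde kn G - 2 * kn) * (c * (R G + kn\<^sup>2) * (k_tilde kn G + kn)) = G * (c * G)"
      by algebra
    then have "(2 * k_tilde kn G - 2 * kn) / (c * G) = G / (c * (R G + kn\<^sup>2) * (k_tilde kn G + kn))"
      using that c pos[of G] by (subst frac_eq_eq) auto
    then show ?thesis
      by (simp add: life_time_def diff_divide_distrib)
  qed
  have R_lim: "(R \<longlongrightarrow> R 0) (at_right 0)"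
    unfolding R_def by (intro tendsto_intros)
  \<comment> \<open>Only a nonzero limit of the denominator matters, so \<open>R 0\<close> is left
    unevaluated.\<close>
  have "((\<lambda>G. G / (c * (R G + kn\<^sup>2) * (k_tilde kn G + kn))) \<longlongrightarrow>
           0 / (c * (R 0 + kn\<^sup>2) * (kn + kn))) (at_right 0)"
  proof (intro tendsto_divide tendsto_mult tendsto_add tendsto_const tendsto_ident_at)
    show "(R \<longlongrightarrow> R 0) (at_right 0)" "(k_tilde kn \<longlongrightarrow> kn) (at_right 0)"
      by (fact R_lim, fact k_tilde_narrow_resonance[OF kn])
    have "R 0 + kn\<^sup>2 > 0"
      using kn R[of 0] by (intro add_nonneg_pos) auto
    then show "c * (R 0 + kn\<^sup>2) * (kn + kn) \<noteq> 0"
      using c kn by simp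
  qed
  moreover have "eventually (\<lambda>G. G / (c * (R G + kn\<^sup>2) * (k_tilde kn G + kn)) =
                   life_time c kn G - 2 * kn / (c * G)) (at_right 0)"
    using eventually_at_right_less[of "0::real"] by (rule eventually_mono) (simp add: eq)
  ultimately show ?thesis
    by (simp add: tendsto_cong)
qed

section \<open>The resonant part of the excited field\<close>

lemma set_integrable_mult_bounded:
  fixes f g :: "'a \<Rightarrow> complex"
  assumes f: "set_integrable M X f"
    and g: "g \<in> borel_measurable M" "\<And>x. norm (g x) \<le> B"
  shows "set_integrable M X (\<lambda>x. f x * g x)"
proof -
  have "integrable M (\<lambda>x. g x * (indicator X x *\<^sub>R f x))"
  proof (rule Bochner_Integration.integrable_bound)
    show "integrable M (\<lambda>x. B *\<^sub>R (indicator X x *\<^sub>R f x))"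
      using f by (simp add: set_integrable_def del: scaleR_scaleR)
    show "(\<lambda>x. g x * (indicator X x *\<^sub>R f x)) \<in> borel_measurable M"
      using f by (intro borel_measurable_times g(1)) (simp add: set_integrable_def borel_measurable_integrable)
    show "AE x in M. norm (g x * (indicator X x *\<^sub>R f x)) \<le> norm (B *\<^sub>R (indicator X x *\<^sub>R f x))"
    proof (intro AE_I2)
      fix x
      have "norm (g x) \<le> \<bar>B\<bar>"
        using g(2)[of x] by linarith
      then show "norm (g x * (indicator X x *\<^sub>R f x)) \<le> norm (B *\<^sub>R (indicator X x *\<^sub>R f x))"
        by (auto simp: norm_mult indicator_def intro: mult_right_mono)
    qed
  qed
  then show ?thesis
    by (simp add: set_integrable_def mult.commute)
qed

text \<open>For real k the denominator has imaginary part \<open>- Im \<zeta>n\<close>, so its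
  modulus is at least \<open>\<bar>Im \<zeta>n\<bar>\<close>. The factor multiplying A is therefore
  bounded and continuous, and integrability is inherited from A.\<close>

lemma set_integrable_amplitude_integrand:
  assumes A: "set_integrable lborel {0<..} (\<lambda>k. A (of_real k))" and im: "Im \<zeta>n \<noteq> 0"
  shows "set_integrable lborel {0<..} (\<lambda>k. amplitude_integrand c A \<zeta>n a t (of_real k))"
proof -
  define g where "g = (\<lambda>k::real. exp (- \<i> * of_real c * of_real k * of_real t) / ((of_real k)\<^sup>2 - \<zeta>n))"
  have "(of_real k)\<^sup>2 - \<zeta>n \<noteq> 0" for k :: real
    using im by (auto simp: complex_eq_iff Re_power2 Im_power2)
  then have "continuous_on UNIV g"
    unfolding g_def by (intro continuous_intros) auto
  then have "g \<in> borel_measurable lborel"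
    by (simp add: borel_measurable_continuous_onI)
  moreover have "norm (g k) \<le> 1 / \<bar>Im \<zeta>n\<bar>" for k
  proof -
    have "\<bar>Im \<zeta>n\<bar> \<le> norm ((of_real k)\<^sup>2 - \<zeta>n)"
      using abs_Im_le_cmod[of "(of_real k)\<^sup>2 - \<zeta>n"] by (simp add: Im_power2)
    then show ?thesis
      using im by (simp add: g_def norm_divide frac_le)
  qed
  ultimately have "set_integrable lborel {0<..} (\<lambda>k. A (of_real k) * g k)"
    by (rule set_integrable_mult_bounded[OF A])
  then have "set_integrable lborel {0<..} (\<lambda>k. a * (A (of_real k) * g k))"
    by simp
  then show ?thesis
    by (simp add: amplitude_integrand_def g_def)
qed

text \<open>Linearity of the integral after adding and subtracting the resonant term. Both
  integrands must be integrable for this. In the application each \<open>Estat k\<close> is known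
  only up to a null set, so integrability in k at the fixed point r is a hypothesis.\<close>

lemma excited_field_split:
  assumes A: "set_integrable lborel {0<..} (\<lambda>k. A (of_real k))" and im: "Im \<zeta>n \<noteq> 0"
    and field: "set_integrable lborel {0<..} (\<lambda>k. A (of_real k) * Estat k r)"
  shows "excited_field c A Estat r t = Re (siegert_amplitude c A \<zeta>n a t * E r) +
           excited_field c A (\<lambda>k r. Estat k r - a / (of_real (k\<^sup>2) - \<zeta>n) * E r) r t"
proof -
  define f where "f = (\<lambda>k. A (of_real k) * Estat k r * exp (- \<i> * of_real (c * k * t)))"
  define h where "h = (\<lambda>k::real. amplitude_integrand c A \<zeta>n a t (of_real k) * E r)"
  have "continuous_on UNIV (\<lambda>k::real. exp (- \<i> * of_real (c * k * t)))"
    by (intro continuous_intros)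
  then have "(\<lambda>k::real. exp (- \<i> * of_real (c * k * t))) \<in> borel_measurable lborel"
    by (simp add: borel_measurable_continuous_onI)
  then have f: "set_integrable lborel {0<..} f"
    unfolding f_def using set_integrable_mult_bounded[OF field, of _ 1] by simp
  have h: "set_integrable lborel {0<..} h"
    using set_integrable_amplitude_integrand[OF A im] by (simp add: h_def)
  have "A (of_real k) * (Estat k r - a / (of_real (k\<^sup>2) - \<zeta>n) * E r) * exp (- \<i> * of_real (c * k * t))
          = f k - h k" for k
    by (simp add: f_def h_def amplitude_integrand_def algebra_simps)
  then have "excited_field c A (\<lambda>k r. Estat k r - a / (of_real (k\<^sup>2) - \<zeta>n) * E r) r t =
               Re ((LINT k:{0<..}|lborel. f k) - (LINT k:{0<..}|lborel. h k))"
    by (simp add: excited_field_def set_integral_diff(2)[OF f h])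
  moreover have "(LINT k:{0<..}|lborel. h k) = siegert_amplitude c A \<zeta>n a t * E r"
    by (simp add: h_def siegert_amplitude_def)
  moreover have "excited_field c A Estat r t = Re (LINT k:{0<..}|lborel. f k)"
    by (simp add: excited_field_def f_def)
  ultimately show ?thesis
    by simp
qed

section \<open>Contour deformation and the residue at the pole\<close>

lemma set_lebesgue_integral_linepath:
  fixes f :: "complex \<Rightarrow> complex"
  assumes "p < q" and int: "set_integrable lborel {p..q} (\<lambda>k. f (of_real k))"
  shows "(LINT k:{p..q}|lborel. f (of_real k)) = contour_integral (linepath (of_real p) (of_real q)) f"
proof -
  \<comment> \<open>The gauge integral links the Lebesgue integral to the contour integral along a
    real segment. Passing to it requires the completed measure.\<close>
  have "((\<lambda>k. f (of_real k)) has_integral (LINT k:{p..q}|lborel. f (of_real k))) {p..q}"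
    using has_integral_set_lebesgue[of "{p..q}" "\<lambda>k. f (of_real k)"] int
    by (simp add: set_integrable_def set_lebesgue_integral_def integrable_completion integral_completion)
  then have "(f has_contour_integral (LINT k:{p..q}|lborel. f (of_real k)))
               (linepath (of_real p) (of_real q))"
    using assms by (subst has_contour_integral_linepath_Reals_iff) auto
  then show ?thesis
    by (simp add: contour_integral_unique)
qed

lemma set_integral_split_interval:
  fixes f :: "real \<Rightarrow> complex"
  assumes "0 < p" "p < q" and int: "set_integrable lborel {0<..} f"
  shows "(LINT k:{0<..}|lborel. f k) =
           (LINT k:{0<..<p}|lborel. f k) + (LINT k:{p..q}|lborel. f k) + (LINT k:{q<..}|lborel. f k)"
proof -
  have int_sub: "set_integrable lborel {0<..<p} f" "set_integrable lborel {p..q} f"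
      "set_integrable lborel {q<..} f" "set_integrable lborel ({0<..<p} \<union> {p..q}) f"
    using assms(1,2) by (auto intro!: set_integrable_subset[OF int])
  have disjoint: "({0<..<p} \<union> {p..q}) \<inter> {q<..} = {}" "{0<..<p} \<inter> {p..q} = {}"
    using assms(1,2) by auto
  have "{0<..} = ({0<..<p} \<union> {p..q}) \<union> {q<..}"
    using assms(1,2) by auto
  then show ?thesis
    by (simp only: set_integral_Un[OF disjoint(1) int_sub(4,3)] set_integral_Un[OF disjoint(2) int_sub(1,2)])
qed

text \<open>The second zero \<open>- s\<close> of the denominator lies in the left half-plane, hence
  outside S.\<close>

lemma amplitude_integrand_holomorphic:
  assumes "A holomorphic_on S" "S \<subseteq> {k. Re k > 0}" "Re s > 0"
  shows "amplitude_integrand c A (s\<^sup>2) a t holomorphic_on S - {s}"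
proof -
  have "k\<^sup>2 - s\<^sup>2 \<noteq> 0" if "k \<in> S - {s}" for k
  proof -
    have "k \<noteq> - s"
      using that assms by auto
    with that show ?thesis
      by (auto simp: power2_eq_iff)
  qed
  moreover have "A holomorphic_on S - {s}"
    using assms by (auto intro: holomorphic_on_subset)
  ultimately show ?thesis
    unfolding amplitude_integrand_def by (intro holomorphic_intros) auto
qed

text \<open>Splitting the denominator into (k - s)(k + s) leaves a numerator g holomorphic on S; the
  residue is \<open>g s\<close>, and k + s contributes the factor \<open>2 * s\<close>.\<close>

lemma residue_amplitude_integrand:
  assumes S: "open S" "s \<in> S" "A holomorphic_on S" "S \<subseteq> {k. Re k > 0}"
  shows "residue (amplitude_integrand c A (s\<^sup>2) a t) s =
           a * A s * exp (- \<i> * of_real c * of_real t * s) / (2 * s)"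
proof -
  define g where "g = (\<lambda>k. a * A k * exp (- \<i> * of_real c * k * of_real t) / (k + s))"
  have pos: "k + s \<noteq> 0" if "k \<in> S" for k
  proof -
    have "Re k > 0" "Re s > 0"
      using that S by auto
    then show ?thesis
      by (auto simp: complex_eq_iff)
  qed
  have "g holomorphic_on S"
    unfolding g_def using S pos by (intro holomorphic_intros) auto
  \<comment> \<open>This holds on the whole plane: at \<open>s\<close> and \<open>- s\<close> both
    sides are 0, because division by zero yields 0.\<close>
  moreover have "amplitude_integrand c A (s\<^sup>2) a t = (\<lambda>k. g k / (k - s))"
    by (simp add: fun_eq_iff amplitude_integrand_def g_def square_diff_square_factored power2_eq_square)
  ultimately have "residue (amplitude_integrand c A (s\<^sup>2) a t) s = g s"
    using residue_simple[OF S(1,2)] by simp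
  then show ?thesis
    by (simp add: g_def mult_2 ac_simps)
qed

text \<open>The residue theorem for the loop that runs along g and back along h. Simple
  connectedness of S ensures that this loop does not wind around any point outside S.\<close>

lemma residue_theorem_contour_deformation:
  assumes S: "open S" "simply_connected S" and f: "f holomorphic_on S - {s}"
    and g: "valid_path g" "path_image g \<subseteq> S - {s}"
    and h: "valid_path h" "path_image h \<subseteq> S - {s}"
    and ends: "pathstart h = pathstart g" "pathfinish h = pathfinish g"
  shows "contour_integral g f =
           2 * of_real pi * \<i> * winding_number (g +++ reversepath h) s * residue f s
             + contour_integral h f"
proof -
  let ?l = "g +++ reversepath h"
  have l: "valid_path ?l" "pathfinish ?l = pathstart ?l" "path_image ?l \<subseteq> S - {s}"
    using g h ends by (auto simp: path_image_join)
  have "winding_number ?l z = 0" if "z \<notin> S" for z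
    using that l S(2) by (intro simply_connected_imp_winding_number_zero[of S]) (auto intro: valid_path_imp_path)
  then have "contour_integral ?l f =
               2 * of_real pi * \<i> * (\<Sum>p\<in>{s}. winding_number ?l p * residue f p)"
    using Residue_theorem[of S "{s}" f ?l] S f l by (simp add: simply_connected_imp_connected)
  moreover have "open (S - {s})"
    using S by auto
  then have "f contour_integrable_on g" "f contour_integrable_on h"
    using f g h by (auto intro: contour_integrable_holomorphic_simple)
  then have "contour_integral ?l f = contour_integral g f - contour_integral h f"
    using g h by (simp add: contour_integrable_reversepath contour_integral_reversepath)
  ultimately show ?thesis
    by (simp add: algebra_simps)
qed

text \<open>A is continued only to S, so just the piece from p to q is deformed and the two tails
  stay on the real axis. Winding number -1 says that the pole is encircled once clockwise, which
  matches the sign in \<open>pole_contribution\<close>.\<close>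

lemma siegert_amplitude_contour_deformation:
  assumes A: "set_integrable lborel {0<..} (\<lambda>k. A (of_real k))" "A holomorphic_on S"
    and S: "open S" "simply_connected S" "S \<subseteq> {k. Re k > 0}"
    and s: "Re (sqrt_cut \<zeta>n) > 0" "Im (sqrt_cut \<zeta>n) < 0" "(sqrt_cut \<zeta>n)\<^sup>2 = \<zeta>n"
    and pq: "0 < p" "p < q" "closed_segment (of_real p) (of_real q) \<subseteq> S"
    and \<gamma>: "valid_path \<gamma>" "pathstart \<gamma> = of_real p" "pathfinish \<gamma> = of_real q"
           "path_image \<gamma> \<subseteq> S - {sqrt_cut \<zeta>n}"
    and winding: "winding_number (linepath (of_real p) (of_real q) +++ reversepath \<gamma>) (sqrt_cut \<zeta>n) = -1"
  shows "siegert_amplitude c A \<zeta>n a t = pole_contribution c A \<zeta>n a t +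
           ((LINT k:{0<..<p}|lborel. amplitude_integrand c A \<zeta>n a t (of_real k)) +
            contour_integral \<gamma> (amplitude_integrand c A \<zeta>n a t) +
            (LINT k:{q<..}|lborel. amplitude_integrand c A \<zeta>n a t (of_real k)))"
proof -
  let ?f = "amplitude_integrand c A \<zeta>n a t"
  let ?s = "sqrt_cut \<zeta>n"
  have "Im (?s\<^sup>2) \<noteq> 0"
    using s(1,2) by (simp add: Im_power2)
  then have int: "set_integrable lborel {0<..} (\<lambda>k. ?f (of_real k))"
    using set_integrable_amplitude_integrand[OF A(1)] by (simp add: s(3))
  have "?s \<notin> closed_segment (of_real p) (of_real q)"
    using s(2) by (auto simp: in_segment)
  then have seg: "path_image (linepath (of_real p) (of_real q)) \<subseteq> S - {?s}"
    using pq by auto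
  have "?f holomorphic_on S - {?s}"
    using amplitude_integrand_holomorphic[OF A(2) S(3) s(1)] by (simp add: s(3))
  then have "contour_integral (linepath (of_real p) (of_real q)) ?f =
               pole_contribution c A \<zeta>n a t + contour_integral \<gamma> ?f"
    using residue_theorem_contour_deformation[OF S(1,2) _ _ seg \<gamma>(1,4)] \<gamma>(2,3) winding
    by (simp add: pole_contribution_def)
  moreover have "set_integrable lborel {p..q} (\<lambda>k. ?f (of_real k))"
    using pq by (intro set_integrable_subset[OF int]) auto
  ultimately show ?thesis
    using set_integral_split_interval[OF pq(1,2) int] set_lebesgue_integral_linepath[OF pq(2), of ?f]
    by (simp add: siegert_amplitude_def)
qed

section \<open>The decay law\<close>

theorem mainTheorem3:
  fixes c zm zp kn \<Gamma> \<sigma> :: real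
    and \<epsilon> :: "real \<times> real \<Rightarrow> real"
    and E :: field
    and Estat :: "real \<Rightarrow> field"
    and \<zeta>n a :: complex
    and A :: "complex \<Rightarrow> complex"
    and S :: "complex set"
  assumes c: "c > 0"
    and strip: "zm < zp"
    and eps: "dielectric zm zp \<epsilon>"
    and meromorphic: "resolvent_meromorphic (cell zm zp) \<epsilon>"
    and simple_poles: "\<And>\<zeta>0 N P. resolvent_pole (cell zm zp) \<epsilon> \<zeta>0 N P \<Longrightarrow>
                         N = 1 \<and> rank_one (cell zm zp) (P 1)"
    and zeta: "kn > 0" "\<Gamma> > 0" "\<zeta>n = of_real (kn\<^sup>2) - \<i> * of_real \<Gamma>"
    and pole: "\<exists>N P. resolvent_pole (cell zm zp) \<epsilon> \<zeta>n N P"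
    and siegert: "siegert_state (cell zm zp) \<epsilon> \<zeta>n E"
    and sigma: "\<sigma> \<in> {1, -1}"
    and resonant_term: "resonant_coefficient (cell zm zp) \<epsilon> \<sigma> \<zeta>n E a"
    and stationary: "\<And>k. k > 0 \<Longrightarrow> L2_eq (cell zm zp) (Estat k)
                       (stationary_amplitude (cell zm zp) \<epsilon> \<sigma> (of_real (k\<^sup>2)))"
    and A_integrable: "set_integrable lborel {0<..} (\<lambda>k. A (of_real k))"
    and A_continuation: "open S" "simply_connected S" "S \<subseteq> {k. Re k > 0}"
          "\<exists>k::real. of_real k \<in> S" "sqrt_cut \<zeta>n \<in> S" "A holomorphic_on S"
  shows
    \<comment> \<open>real and imaginary part of the pole in the wavenumber plane\<close>
    "k_tilde kn \<Gamma> > 0 \<and> life_time c kn \<Gamma> > 0 \<and>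
     sqrt_cut \<zeta>n = of_real (k_tilde kn \<Gamma>) - \<i> / of_real (c * life_time c kn \<Gamma>) \<and>
     \<comment> \<open>the Siegert state appears in the excited field with the amplitude \<open>siegert_amplitude\<close>\<close>
     (\<forall>t r. set_integrable lborel {0<..} (\<lambda>k. A (of_real k) * Estat k r) \<longrightarrow>
        excited_field c A Estat r t = Re (siegert_amplitude c A \<zeta>n a t * E r) +
          excited_field c A (\<lambda>k r. Estat k r - a / (of_real (k\<^sup>2) - \<zeta>n) * E r) r t) \<and>
     \<comment> \<open>the contribution of the pole is what the amplitude picks up when the
         integration contour is replaced by one that passes the pole on the other side\<close>
     (\<forall>p q t \<gamma>. 0 < p \<and> p < q \<and> closed_segment (of_real p) (of_real q) \<subseteq> S \<and>
        valid_path \<gamma> \<and> pathstart \<gamma> = of_real p \<and> pathfinish \<gamma> = of_real q \<and>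
        path_image \<gamma> \<subseteq> S - {sqrt_cut \<zeta>n} \<and>
        winding_number (linepath (of_real p) (of_real q) +++ reversepath \<gamma>) (sqrt_cut \<zeta>n) = -1 \<longrightarrow>
        siegert_amplitude c A \<zeta>n a t = pole_contribution c A \<zeta>n a t +
          ((LINT k:{0<..<p}|lborel. amplitude_integrand c A \<zeta>n a t (of_real k)) +
           contour_integral \<gamma> (amplitude_integrand c A \<zeta>n a t) +
           (LINT k:{q<..}|lborel. amplitude_integrand c A \<zeta>n a t (of_real k)))) \<and>
     (\<forall>t. pole_contribution c A \<zeta>n a t =
        - (of_real pi * \<i> * a / sqrt_cut \<zeta>n) * A (sqrt_cut \<zeta>n) *
          exp (- \<i> * of_real c * of_real t * sqrt_cut \<zeta>n)) \<and>
     \<comment> \<open>oscillation at the single wavenumber \<open>k_tilde\<close>, damped with the given life time\<close>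
     (\<forall>t. pole_contribution c A \<zeta>n a t = pole_contribution c A \<zeta>n a 0 *
        exp (- \<i> * of_real (c * k_tilde kn \<Gamma> * t)) * of_real (exp (- t / life_time c kn \<Gamma>))) \<and>
     (\<forall>t r. Re (pole_contribution c A \<zeta>n a t * E r) = exp (- t / life_time c kn \<Gamma>) *
        Re (pole_contribution c A \<zeta>n a 0 * E r * exp (- \<i> * of_real (c * k_tilde kn \<Gamma> * t)))) \<and>
     \<comment> \<open>narrow resonances\<close>
     (k_tilde kn \<longlongrightarrow> kn) (at_right 0) \<and>
     (life_time c kn \<sim>[at_right 0] (\<lambda>G. 2 * kn / (c * G))) \<and>
     ((\<lambda>G. life_time c kn G - 2 * kn / (c * G)) \<longlongrightarrow> 0) (at_right 0)"
proof -
  let ?s = "sqrt_cut \<zeta>n"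
  have kt: "k_tilde kn \<Gamma> > 0"
    using zeta(2) by (rule k_tilde_pos)
  then have lt: "life_time c kn \<Gamma> > 0"
    using c zeta(2) by (simp add: life_time_def)
  have s_eq: "?s = Complex (k_tilde kn \<Gamma>) (- \<Gamma> / (2 * k_tilde kn \<Gamma>))"
    using sqrt_cut_resonance[OF zeta(1,2)] by (simp add: zeta(3))
  then have s: "Re ?s > 0" "Im ?s < 0"
    using kt zeta(2) by (simp_all add: divide_neg_pos)
  have sq: "?s\<^sup>2 = \<zeta>n"
    using zeta by (intro sqrt_cut_squared) (auto simp: complex_eq_iff)
  have im: "Im \<zeta>n \<noteq> 0"
    using zeta by simp
  have s_form: "?s = of_real (k_tilde kn \<Gamma>) - \<i> / of_real (c * life_time c kn \<Gamma>)"
    using c kt zeta(2) by (simp add: s_eq life_time_def complex_eq_iff Re_divide Im_divide power2_eq_square)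
  have pole_form: "pole_contribution c A \<zeta>n a t =
        - (of_real pi * \<i> * a / ?s) * A ?s * exp (- \<i> * of_real c * of_real t * ?s)" for t
    using residue_amplitude_integrand[OF A_continuation(1,5,6,3), of c a t]
    by (simp add: pole_contribution_def sq)
  \<comment> \<open>The imaginary part of the root turns the phase into a real exponent: the product
    of the two factors \<open>- \<i>\<close> is -1, and c cancels.\<close>
  have "- \<i> * of_real c * of_real t * ?s =
          - \<i> * of_real (c * k_tilde kn \<Gamma> * t) + of_real (- t / life_time c kn \<Gamma>)" for t
    using c lt by (simp add: s_form field_simps)
  then have decay: "pole_contribution c A \<zeta>n a t = pole_contribution c A \<zeta>n a 0 *
        exp (- \<i> * of_real (c * k_tilde kn \<Gamma> * t)) * of_real (exp (- t / life_time c kn \<Gamma>))" for t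
    by (simp only: pole_form exp_add exp_of_real) simp
  have Re_of_real_mult: "Re (of_real x * z) = x * Re z" for x z
    by simp
  have product_decay: "pole_contribution c A \<zeta>n a t * E r = of_real (exp (- t / life_time c kn \<Gamma>)) *
          (pole_contribution c A \<zeta>n a 0 * E r * exp (- \<i> * of_real (c * k_tilde kn \<Gamma> * t)))" for t r
    by (subst decay) (simp only: ac_simps)
  \<comment> \<open>The damping factor is real and leaves \<open>Re\<close>; the oscillating phase
    is complex and has to stay inside.\<close>
  have field_decay: "Re (pole_contribution c A \<zeta>n a t * E r) = exp (- t / life_time c kn \<Gamma>) *
        Re (pole_contribution c A \<zeta>n a 0 * E r * exp (- \<i> * of_real (c * k_tilde kn \<Gamma> * t)))" for t r
    by (subst product_decay) (rule Re_of_real_mult)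
  note split = excited_field_split[where A = A, OF A_integrable im]
  note deformation = siegert_amplitude_contour_deformation[where A = A,
      OF A_integrable A_continuation(6,1,2,3) s sq]
  show ?thesis
    by (intro conjI allI impI kt lt s_form pole_form decay field_decay
        k_tilde_narrow_resonance[OF zeta(1)] life_time_narrow_resonance[OF c zeta(1)]
        life_time_narrow_resonance_diff[OF c zeta(1)];
        (rule split, assumption | elim conjE, rule deformation; assumption))
qed

end
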